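(* Let $\Pi$ be a well-conditioned probability measure on $\mathbb{R}^d$ whose potential $U$ has a multiplicative Hessian, that is, $\nabla^2U(x)=Z^T\Lambda(x)Z$ for all $x\in\mathbb{R}^d$, with $Z\in\mathbb{R}^{n\times d}$, $n\ge d$, and $\Lambda(x)\in\mathbb{R}^{n\times n}$. Let $x^*\in\mathbb{R}^d$. Then choosing the preconditioner $L=(Z^T\Lambda(x^* )Z)^{1/2}$ gives a condition number $\tilde\kappa$ satisfying \[ \tilde\kappa\le\frac{\sup_{x\in\mathbb{R}^d}\lambda_1\bigl(\Lambda(x^* )^{-1/2}\Lambda(x)\Lambda(x^* )^{-1/2}\bigr)}{\inf_{x\in\mathbb{R}^d}\lambda_d\bigl(\Lambda(x^* )^{-1/2}\Lambda(x)\Lambda(x^* )^{-1/2}\bigr)}\le\left(\frac{\sup_{x\in\mathbb{R}^d}\lambda_1(\Lambda(x))}{\inf_{x\in\mathbb{R}^d}\lambda_d(\Lambda(x))}\right)^2. \]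
   Context: $\Pi$ has density $\propto\exp(-U)$, where $U$ is called the potential; $\Pi$ is well-conditioned if $U\in C^2(\mathbb{R}^d)$ and $m\mathbf{I}_d\preceq\nabla^2U(x)\preceq M\mathbf{I}_d$ for all $x$, for some $M\ge m>0$. The condition number after preconditioning with $L\in GL_d(\mathbb{R})$ (that is, of the law of $LX$, $X\sim\Pi$) is $\tilde\kappa=\sup_{x}\|L^{-T}\nabla^2U(x)L^{-1}\|\,\sup_{x}\|L\nabla^2U(x)^{-1}L^{T}\|$ (operator 2-norm). $\lambda_i(A)$ denotes the $i$-th largest eigenvalue of a symmetric matrix $A$.
   Formalization: λ_d in both denominators is replaced by the least eigenvalue λ_n (the same for n = d; for n > d the printed claim is false); a quotient is +∞ when its infimum is ≤ 0; Λ(x) is taken symmetric and Λ(x* ) positive definite so that the expressions make sense. *)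

theory Defs
  imports "HOL-Probability.Probability" "HOL-Computational_Algebra.Polynomial"
begin

subsection \<open>Symmetric matrices\<close>

definition symmetric_matrix :: "real^'n^'n \<Rightarrow> bool" where
  "symmetric_matrix A \<longleftrightarrow> transpose A = A"

definition pos_semidef :: "real^'n^'n \<Rightarrow> bool" where
  "pos_semidef A \<longleftrightarrow> symmetric_matrix A \<and> (\<forall>v. 0 \<le> v \<bullet> (A *v v))"

definition pos_def :: "real^'n^'n \<Rightarrow> bool" where
  "pos_def A \<longleftrightarrow> symmetric_matrix A \<and> (\<forall>v. v \<noteq> 0 \<longrightarrow> 0 < v \<bullet> (A *v v))"

definition loewner_le :: "real^'n^'n \<Rightarrow> real^'n^'n \<Rightarrow> bool" (infix "\<preceq>" 50) where
  "A \<preceq> B \<longleftrightarrow> pos_semidef (B - A)"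

text \<open>The principal square root; meaningful only for positive semidefinite matrices.\<close>

definition matrix_sqrt :: "real^'n^'n \<Rightarrow> real^'n^'n" where
  "matrix_sqrt A = (THE S. pos_semidef S \<and> S ** S = A)"

definition charpoly :: "real^'n^'n \<Rightarrow> real poly" where
  "charpoly A = det (\<chi> i j. (if i = j then [:0, 1:] else 0) - [:A $ i $ j:])"

text \<open>
  The \<open>i\<close>-th largest eigenvalue, counted with multiplicity, for \<open>1 \<le> i \<le> n\<close>.
  Only real roots of the characteristic polynomial are listed; a symmetric
  \<open>n \<times> n\<close> matrix has exactly \<open>n\<close> of them.
\<close>

definition eigval :: "nat \<Rightarrow> real^'n^'n \<Rightarrow> real" where
  "eigval i A = rev (sorted_list_of_multiset (proots (charpoly A))) ! (i - 1)"

definition op_norm :: "real^'n^'m \<Rightarrow> real" where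
  "op_norm A = onorm (\<lambda>v. A *v v)"

subsection \<open>Potentials\<close>

definition gradient :: "(real^'d \<Rightarrow> real) \<Rightarrow> real^'d \<Rightarrow> real^'d" where
  "gradient U x = (\<chi> i. frechet_derivative U (at x) (axis i 1))"

definition hessian :: "(real^'d \<Rightarrow> real) \<Rightarrow> real^'d \<Rightarrow> real^'d^'d" where
  "hessian U x = matrix (frechet_derivative (gradient U) (at x))"

definition C2 :: "(real^'d \<Rightarrow> real) \<Rightarrow> bool" where
  "C2 U \<longleftrightarrow> (\<forall>x. U differentiable (at x)) \<and> (\<forall>x. gradient U differentiable (at x)) \<and>
     continuous_on UNIV (hessian U)"

definition has_potential :: "(real^'d) measure \<Rightarrow> (real^'d \<Rightarrow> real) \<Rightarrow> bool" where
  "has_potential P U \<longleftrightarrow> (\<exists>c>0. P = density lborel (\<lambda>x. ennreal (c * exp (- U x))))"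

definition well_conditioned :: "(real^'d) measure \<Rightarrow> (real^'d \<Rightarrow> real) \<Rightarrow> bool" where
  "well_conditioned P U \<longleftrightarrow> prob_space P \<and> has_potential P U \<and> C2 U \<and>
     (\<exists>m M. 0 < m \<and> m \<le> M \<and> (\<forall>x. mat m \<preceq> hessian U x \<and> hessian U x \<preceq> mat M))"

definition multiplicative_hessian ::
    "(real^'d \<Rightarrow> real) \<Rightarrow> real^'d^'n \<Rightarrow> (real^'d \<Rightarrow> real^'n^'n) \<Rightarrow> bool" where
  "multiplicative_hessian U Z \<Lambda> \<longleftrightarrow> CARD('n) \<ge> CARD('d) \<and>
     (\<forall>x. hessian U x = transpose Z ** \<Lambda> x ** Z)"

subsection \<open>Condition numbers\<close>

text \<open>Suprema are taken in \<^typ>\<open>ennreal\<close>, so that unbounded families yield \<open>\<infinity>\<close>.\<close>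

definition precond_condition_number :: "(real^'d \<Rightarrow> real) \<Rightarrow> real^'d^'d \<Rightarrow> ennreal" where
  "precond_condition_number U L =
     (SUP x. ennreal (op_norm (matrix_inv (transpose L) ** hessian U x ** matrix_inv L))) *
     (SUP x. ennreal (op_norm (L ** matrix_inv (hessian U x) ** transpose L)))"

text \<open>
  The intended quotients of extreme eigenvalues are
  \<open>(SUP x. ennreal (eigval 1 (A x))) / (INF x. ennreal (eigval n (A x)))\<close>.
  The conversion to \<^typ>\<open>ennreal\<close> sends negative reals to \<open>0\<close>, and \<open>a / 0 = \<infinity>\<close> for
  \<open>a > 0\<close>; hence the quotient is \<open>\<infinity>\<close> when the infimum of the least eigenvalues is not
  positive, as long as some \<open>A x\<close> has a positive eigenvalue.

  The index of the least eigenvalue is the size \<open>n\<close> of the matrices.  For a Hessian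
  \<open>Z\<^sup>T \<Lambda>(x) Z\<close> of smaller size \<open>d < n\<close>, the \<open>d\<close>-th largest eigenvalues would not bound the
  condition number: with \<open>d = 1\<close>, \<open>n = 2\<close>, \<open>Z = (1, 1)\<^sup>T\<close>, \<open>\<Lambda>(x) = diag(1, b(x))\<close> and
  \<open>0 < b(x) \<le> b(0) = 1\<close>, preconditioning at \<open>0\<close>, that quotient equals \<open>1\<close> while the Hessian
  \<open>1 + b(x)\<close> need not be constant.
\<close>

end

theory Submission
  imports Defs
begin

text \<open>
  Let \<open>S = \<Lambda>(x\<^sup>*)\<^sup>1\<^sup>/\<^sup>2\<close> and \<open>W = S Z L\<^sup>-\<^sup>1\<close>.  Since \<open>L\<^sup>2 = Z\<^sup>T \<Lambda>(x\<^sup>*) Z\<close>, the matrix \<open>W\<close> is an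
  isometry, and the preconditioned Hessian is \<open>W\<^sup>T A(x) W\<close> with \<open>A(x) = S\<^sup>-\<^sup>1 \<Lambda>(x) S\<^sup>-\<^sup>1\<close>.  Its Rayleigh
  quotients therefore lie between the extreme eigenvalues of \<open>A(x)\<close>, which gives the first
  inequality.  The second compares the Rayleigh quotients of \<open>A(x)\<close> with those of \<open>\<Lambda>(x)\<close>, using
  that \<open>|S\<^sup>-\<^sup>1 v|\<^sup>2 / |v|\<^sup>2\<close> lies between the reciprocals of the extreme eigenvalues of \<open>\<Lambda>(x\<^sup>*)\<close>.
\<close>

subsection \<open>Diagonalization of symmetric matrices\<close>

text \<open>Compactness of the unit sphere of \<open>S\<close> gives a maximizer of
  \<open>x \<bullet> f x\<close>, which turns out to be an eigenvector. Working in an invariant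
  subspace lets the argument be repeated on orthogonal complements.\<close>

lemma selfadjoint_eigenvector_in_subspace:
  fixes f :: "'a::euclidean_space \<Rightarrow> 'a"
  assumes f: "linear f" "\<And>x y. f x \<bullet> y = x \<bullet> f y"
    and S: "subspace S" "\<And>x. x \<in> S \<Longrightarrow> f x \<in> S" "S \<noteq> {0}"
  obtains v c where "v \<in> S" "norm v = 1" "f v = c *\<^sub>R v"
proof -
  let ?K = "S \<inter> sphere 0 1"
  have compact: "compact ?K"
    using S(1) by (simp add: closed_Int_compact closed_subspace)
  obtain u where u: "u \<in> S" "u \<noteq> 0"
    using S(1,3) subspace_0 by blast
  then have "u /\<^sub>R norm u \<in> ?K"
    using S(1) by (simp add: subspace_scale)
  then have ne: "?K \<noteq> {}" by blast
  have "continuous_on ?K (\<lambda>x. x \<bullet> f x)"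
    using f(1) by (intro continuous_on_inner continuous_on_id linear_continuous_on)
      (simp add: linear_linear)
  from continuous_attains_sup[OF compact ne this]
  obtain v where v: "v \<in> S" "norm v = 1"
    and max: "\<And>x. x \<in> S \<Longrightarrow> norm x = 1 \<Longrightarrow> x \<bullet> f x \<le> v \<bullet> f v"
    by auto
  define c where "c = v \<bullet> f v"
  txt \<open>
    The form \<open>c |x|\<^sup>2 - x \<bullet> f x\<close> is nonnegative on \<open>S\<close> and vanishes at \<open>v\<close>; its first variation
    at \<open>v\<close> in the direction \<open>w = c v - f v\<close> forces \<open>w = 0\<close>.
  \<close>
  have bound: "x \<bullet> f x \<le> c * (x \<bullet> x)" if "x \<in> S" for x
  proof (cases "x = 0")
    case False
    have "(x /\<^sub>R norm x) \<bullet> f (x /\<^sub>R norm x) \<le> c"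
      unfolding c_def using False that S(1) by (intro max) (auto simp: subspace_scale)
    then have "(x \<bullet> f x) / (norm x)\<^sup>2 \<le> c"
      by (simp add: linear_scale[OF f(1)] power2_eq_square divide_simps)
    then show ?thesis
      using False by (simp add: divide_simps dot_square_norm mult.commute)
  qed simp
  define w where "w = c *\<^sub>R v - f v"
  define q where "q = c * (w \<bullet> w) - w \<bullet> f w"
  have w: "w \<in> S"
    unfolding w_def using S v by (simp add: subspace_diff subspace_scale)
  have q: "q \<ge> 0"
    using bound[OF w] by (simp add: q_def)
  have vv: "v \<bullet> v = 1"
    using v(2) by (simp add: dot_square_norm)
  have quad: "0 \<le> 2 * t * (w \<bullet> w) + t\<^sup>2 * q" for t
  proof -
    have "v + t *\<^sub>R w \<in> S"
      using v w S(1) by (simp add: subspace_add subspace_scale)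
    from bound[OF this] have
      "0 \<le> c * ((v + t *\<^sub>R w) \<bullet> (v + t *\<^sub>R w)) - (v + t *\<^sub>R w) \<bullet> f (v + t *\<^sub>R w)"
      by simp
    also have "\<dots> = c * (v \<bullet> v) - v \<bullet> f v + 2 * t * (c * (v \<bullet> w) - f v \<bullet> w) + t\<^sup>2 * q"
      using f(2)[of v w]
      by (simp add: linear_add[OF f(1)] linear_scale[OF f(1)] q_def inner_add inner_commute
          power2_eq_square algebra_simps)
    also have "c * (v \<bullet> v) - v \<bullet> f v = 0"
      by (simp add: vv c_def)
    also have "c * (v \<bullet> w) - f v \<bullet> w = w \<bullet> w"
      by (subst (3) w_def) (simp add: inner_diff_left)
    finally show ?thesis by simp
  qed
  have "w \<bullet> w = 0"
  proof (rule ccontr)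
    assume "w \<bullet> w \<noteq> 0"
    then have N: "w \<bullet> w > 0" by simp
    \<comment> \<open>This \<open>t\<close> solves \<open>t * q + t = - (w \<bullet> w)\<close>, so
      the quadratic in \<open>quad\<close> becomes \<open>t * ((w \<bullet> w) - t)\<close>, which
      is negative. The summand 1 keeps the denominator positive when \<open>q = 0\<close>.\<close>
    define t where "t = - (w \<bullet> w) / (q + 1)"
    have t: "t < 0"
      using N q by (simp add: t_def divide_neg_pos)
    have "t * (q + 1) = - (w \<bullet> w)"
      using q by (simp add: t_def)
    then have tq: "t * q + t = - (w \<bullet> w)"
      by (simp add: algebra_simps)
    have "2 * t * (w \<bullet> w) + t\<^sup>2 * q = t * (2 * (w \<bullet> w) + t * q)"
      by (simp add: power2_eq_square algebra_simps)
    also have "\<dots> = t * ((w \<bullet> w) - t)"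
      using tq by (intro arg_cong[where f = "(*) t"]) linarith
    also have "\<dots> < 0"
      using t N by (intro mult_neg_pos) linarith+
    finally show False using quad[of t] by simp
  qed
  then have "f v = c *\<^sub>R v" by (simp add: w_def)
  with v that show thesis by blast
qed

text \<open>By induction on the dimension: after a unit eigenvector \<open>v\<close> is split off,
  the vectors of \<open>S\<close> orthogonal to \<open>v\<close> form a smaller subspace, invariant
  because \<open>v \<bullet> f x = f v \<bullet> x = c * (v \<bullet> x)\<close>.\<close>

lemma selfadjoint_orthonormal_eigenbasis:
  fixes f :: "'a::euclidean_space \<Rightarrow> 'a"
  assumes f: "linear f" "\<And>x y. f x \<bullet> y = x \<bullet> f y"
    and S: "subspace S" "\<And>x. x \<in> S \<Longrightarrow> f x \<in> S"
  shows "\<exists>B\<subseteq>S. pairwise orthogonal B \<and> span B = S \<and>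
           (\<forall>b\<in>B. norm b = 1 \<and> (\<exists>c. f b = c *\<^sub>R b))"
  using S
proof (induction "dim S" arbitrary: S rule: less_induct)
  case less
  show ?case
  proof (cases "S = {0}")
    case True
    then show ?thesis by (intro exI[of _ "{}"]) auto
  next
    case False
    then obtain v c where v: "v \<in> S" "norm v = 1" "f v = c *\<^sub>R v"
      using selfadjoint_eigenvector_in_subspace[OF f less.prems] by blast
    have vv: "v \<bullet> v = 1"
      using v(2) by (simp add: dot_square_norm)
    define T where "T = S \<inter> {x. v \<bullet> x = 0}"
    have T: "subspace T"
      unfolding T_def using less.prems(1) by (simp add: subspace_inter subspace_hyperplane)
    have "v \<notin> T" by (simp add: T_def vv)
    then have "T \<subset> S" using v(1) unfolding T_def by blast
    then have dim: "dim T < dim S"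
      using T less.prems(1) by (intro dim_psubset) (metis span_eq_iff)
    have inv: "f x \<in> T" if "x \<in> T" for x
      using that less.prems(2)[of x] v(3) f(2)[of v x] by (auto simp: T_def)
    from less.hyps[OF dim T inv] obtain B where B: "B \<subseteq> T" "pairwise orthogonal B" "span B = T"
      "\<forall>b\<in>B. norm b = 1 \<and> (\<exists>c. f b = c *\<^sub>R b)" by blast
    show ?thesis
    proof (intro exI[of _ "insert v B"] conjI)
      show "insert v B \<subseteq> S" using B(1) v(1) by (auto simp: T_def)
      show "pairwise orthogonal (insert v B)"
        using B(1,2) by (auto simp: pairwise_insert T_def orthogonal_def inner_commute)
      show "span (insert v B) = S"
      proof
        show "span (insert v B) \<subseteq> S"
          using \<open>insert v B \<subseteq> S\<close> less.prems(1) by (rule span_minimal)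
        show "S \<subseteq> span (insert v B)"
        proof
          fix x assume "x \<in> S"
          then have "x - (v \<bullet> x) *\<^sub>R v \<in> T"
            using v(1) vv less.prems(1) by (simp add: T_def subspace_diff subspace_scale inner_diff_right)
          then show "x \<in> span (insert v B)"
            using B(3) by (auto simp: span_breakdown_eq)
        qed
      qed
      show "\<forall>b\<in>insert v B. norm b = 1 \<and> (\<exists>c. f b = c *\<^sub>R b)"
        using B(4) v by blast
    qed
  qed
qed

section \<open>Diagonal matrices and orthogonal diagonalization\<close>

definition diag :: "('n \<Rightarrow> 'a::zero) \<Rightarrow> 'a^'n^'n" where
  "diag d = (\<chi> i j. if i = j then d i else 0)"

lemma diag_nth [simp]: "diag d $ i $ j = (if i = j then d i else 0)"
  by (simp add: diag_def)

lemma transpose_diag [simp]: "transpose (diag d) = diag d"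
  by (auto simp: vec_eq_iff transpose_def)

lemma diag_mult: "diag d ** diag e = diag (\<lambda>i. d i * e i :: 'a::semiring_1)"
  by (simp add: vec_eq_iff matrix_matrix_mult_def mult_delta_left)

lemma diag_mult_vec_nth: "(diag d *v x) $ i = d i * x $ i"
  by (simp add: matrix_vector_mult_def mult_delta_left)

lemma inner_matrix_vector: "x \<bullet> (A *v y) = (transpose A *v x) \<bullet> (y :: real^'n)"
  by (simp add: dot_lmul_matrix)

lemma symmetric_matrix_inner:
  "symmetric_matrix A \<Longrightarrow> (A *v x) \<bullet> y = x \<bullet> (A *v y)"
  unfolding symmetric_matrix_def by (subst inner_matrix_vector) simp

text \<open>With an orthonormal eigenbasis as the columns of \<open>Q\<close>, the identity
  \<open>A ** Q = Q ** diag d\<close> holds column by column.\<close>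

theorem symmetric_matrix_diagonalization:
  fixes A :: "real^'n^'n"
  assumes "symmetric_matrix A"
  obtains Q d where "orthogonal_matrix Q" "A = Q ** diag d ** transpose Q"
proof -
  obtain B where B: "pairwise orthogonal B" "span B = (UNIV :: (real^'n) set)"
    "\<And>b. b \<in> B \<Longrightarrow> norm b = 1" "\<And>b. b \<in> B \<Longrightarrow> \<exists>c. A *v b = c *\<^sub>R b"
    using selfadjoint_orthonormal_eigenbasis[of "(*v) A" UNIV] symmetric_matrix_inner[OF assms]
    by auto
  have "0 \<notin> B" using B(3) by force
  then have ind: "independent B"
    using B(1) by (rule pairwise_orthogonal_independent[rotated])
  \<comment> \<open>The count allows the basis to be indexed by the type \<open>'n\<close> itself,
    as the columns of a square matrix require.\<close>
  then have "card B = CARD('n)"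
    using B(2) by (metis dim_span_eq_card_independent dim_UNIV DIM_cart DIM_real mult.right_neutral)
  moreover have "finite B" using ind by (rule independent_imp_finite)
  ultimately obtain g where g: "bij_betw g (UNIV :: 'n set) B"
    using finite_same_card_bij[of "UNIV :: 'n set" B] by auto
  then have gB: "g i \<in> B" for i by (auto simp: bij_betw_def)
  then have "\<forall>i. \<exists>c. A *v g i = c *\<^sub>R g i"
    using B(4) by blast
  then obtain d where d: "\<And>i. A *v g i = d i *\<^sub>R g i"
    using choice[of "\<lambda>i c. A *v g i = c *\<^sub>R g i"] by auto
  define Q where "Q = (\<chi> i j. g j $ i)"
  have col: "column j Q = g j" for j
    by (simp add: column_def Q_def vec_eq_iff)
  have "orthogonal (g i) (g j)" if "i \<noteq> j" for i j
    using pairwiseD[OF B(1) gB gB, of i j] g that by (auto simp: bij_betw_def inj_on_def)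
  then have Q: "orthogonal_matrix Q"
    using B(3) gB by (simp add: orthogonal_matrix_orthonormal_columns col)
  have "A ** Q = Q ** diag d"
  proof -
    have "(A ** Q) $ i $ j = (A *v g j) $ i" for i j
      by (simp add: matrix_matrix_mult_def matrix_vector_mult_def Q_def)
    moreover have "(Q ** diag d) $ i $ j = (d j *\<^sub>R g j) $ i" for i j
      by (simp add: matrix_matrix_mult_def Q_def mult_delta_right)
    ultimately show ?thesis using d by (simp add: vec_eq_iff)
  qed
  then have "A = Q ** diag d ** transpose Q"
    using Q by (metis matrix_mul_assoc matrix_mul_rid orthogonal_matrix_def)
  with Q that show thesis by blast
qed

lemma orthogonal_matrix_norm:
  fixes Q :: "real^'n^'n"
  assumes "orthogonal_matrix Q"
  shows "norm (Q *v x) = norm x"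
proof -
  have "orthogonal_transformation ((*v) Q)"
    using assms by (simp add: orthogonal_transformation_matrix)
  then show ?thesis by (rule orthogonal_transformation_norm)
qed

lemma diagonalization_quadratic_form:
  fixes Q :: "real^'n^'n"
  assumes "A = Q ** diag d ** transpose Q"
  shows "x \<bullet> (A *v x) = (\<Sum>i\<in>UNIV. d i * ((transpose Q *v x) $ i)\<^sup>2)"
proof -
  have "x \<bullet> (A *v x) = (transpose Q *v x) \<bullet> (diag d *v (transpose Q *v x))"
    by (simp only: assms flip: matrix_vector_mul_assoc) (simp only: inner_matrix_vector)
  then show ?thesis
    unfolding inner_vec_def diag_mult_vec_nth by (simp add: power2_eq_square mult_ac)
qed

lemma orthogonal_matrix_inner:
  fixes Q :: "real^'n^'n"
  assumes "orthogonal_matrix Q"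
  shows "x \<bullet> x = (\<Sum>i\<in>UNIV. ((transpose Q *v x) $ i)\<^sup>2)"
proof -
  have "x \<bullet> x = (transpose Q *v x) \<bullet> (transpose Q *v x)"
    using assms by (simp only: dot_square_norm orthogonal_matrix_norm orthogonal_matrix_transpose)
  then show ?thesis
    by (simp only: inner_vec_def) (simp add: power2_eq_square)
qed

lemma diagonalization_eigenvector:
  assumes "orthogonal_matrix Q" "A = Q ** diag d ** transpose Q"
  shows "A *v column i Q = d i *\<^sub>R column i Q" and "norm (column i Q :: real^'n) = 1"
proof -
  have "A ** Q = Q ** diag d"
    using assms by (metis matrix_mul_assoc matrix_mul_rid orthogonal_matrix_def)
  then have "A *v column i Q = Q *v (diag d *v axis i 1)"
    by (metis matrix_vector_mult_basis matrix_vector_mul_assoc)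
  also have "diag d *v axis i 1 = d i *\<^sub>R axis i 1"
    by (auto simp: vec_eq_iff diag_mult_vec_nth axis_def)
  finally show "A *v column i Q = d i *\<^sub>R column i Q"
    by (simp add: matrix_vector_mult_scaleR matrix_vector_mult_basis)
  show "norm (column i Q) = 1"
    using assms(1) by (simp add: orthogonal_matrix_orthonormal_columns)
qed

subsection \<open>Extreme eigenvalues and Rayleigh quotients\<close>

lemma matrix_diff_rdistrib: "(A - B) ** C = A ** C - B ** (C :: 'a::ring_1^'k^'n)"
  by (simp add: matrix_matrix_mult_def vec_eq_iff left_diff_distrib sum_subtractf)

lemma matrix_diff_ldistrib: "C ** (A - B) = C ** A - C ** (B :: 'a::ring_1^'k^'n)"
  by (simp add: matrix_matrix_mult_def vec_eq_iff right_diff_distrib sum_subtractf)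

lemma mat_mult_commute: "mat c ** A = A ** mat (c :: 'a::comm_semiring_1)"
  by (simp add: matrix_matrix_mult_def vec_eq_iff mat_def mult_delta_left mult_delta_right
      mult.commute)

text \<open>Embeds real matrices multiplicatively into matrices over the polynomial ring, where
  \<open>charpoly\<close> is a determinant and \<open>det_mul\<close> applies.\<close>

definition const_poly_matrix :: "real^'n^'m \<Rightarrow> real poly^'n^'m" where
  "const_poly_matrix A = (\<chi> i j. [:A $ i $ j:])"

lemma const_poly_matrix_mult:
  "const_poly_matrix (A ** B) = const_poly_matrix A ** const_poly_matrix B"
  by (simp add: const_poly_matrix_def matrix_matrix_mult_def vec_eq_iff sum_to_poly mult.commute)

lemma const_poly_matrix_1: "const_poly_matrix (mat 1) = mat 1"
  by (simp add: const_poly_matrix_def mat_def vec_eq_iff one_pCons)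

lemma charpoly_altdef: "charpoly A = det (mat [:0, 1:] - const_poly_matrix A)"
  unfolding charpoly_def const_poly_matrix_def
  by (rule arg_cong[of _ _ det]) (simp add: vec_eq_iff mat_def)

text \<open>The scalar matrix of the indeterminate commutes with \<open>Q\<close>, so the
  characteristic matrix of \<open>A\<close> is that of \<open>diag d\<close> conjugated by
  \<open>Q\<close>, and the determinants of \<open>Q\<close> and its transpose cancel.\<close>

lemma charpoly_diagonalization:
  assumes Q: "orthogonal_matrix Q" and A: "A = Q ** diag d ** transpose Q"
  shows "charpoly A = (\<Prod>i\<in>UNIV. [:- d i, 1:])"
proof -
  let ?c = const_poly_matrix and ?X = "mat [:0, 1:]"
  have QQ: "?c Q ** ?c (transpose Q) = mat 1"
    using Q by (simp add: orthogonal_matrix_def const_poly_matrix_1 flip: const_poly_matrix_mult)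
  have "?X - ?c A = ?c Q ** (?X - ?c (diag d)) ** ?c (transpose Q)"
    unfolding matrix_diff_rdistrib matrix_diff_ldistrib A const_poly_matrix_mult
    by (metis QQ mat_mult_commute matrix_mul_assoc matrix_mul_rid)
  then have "charpoly A = det (?c Q) * det (?X - ?c (diag d)) * det (?c (transpose Q))"
    by (simp add: charpoly_altdef det_mul)
  also have "\<dots> = det (?c Q ** ?c (transpose Q)) * det (?X - ?c (diag d))"
    by (simp add: det_mul mult_ac)
  also have "\<dots> = det (?X - ?c (diag d))"
    by (simp add: QQ)
  also have "\<dots> = (\<Prod>i\<in>UNIV. [:- d i, 1:])"
    by (subst det_diagonal) (auto simp: const_poly_matrix_def mat_def)
  finally show ?thesis .
qed

lemma proots_charpoly_diagonalization:
  assumes "orthogonal_matrix Q" "A = Q ** diag d ** transpose Q"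
  shows "proots (charpoly A) = image_mset d (mset_set UNIV)"
  unfolding charpoly_diagonalization[OF assms]
  by (subst proots_prod) (auto simp: sum_unfold_sum_mset)

text \<open>Positions \<open>0\<close> and \<open>size M - 1\<close> of the decreasing list are
  those that \<open>eigval\<close> reads for the indices \<open>1\<close> and
  \<open>CARD('n)\<close>.\<close>

lemma rev_sorted_list_of_multiset_extremes:
  assumes "M \<noteq> {#}"
  defines "xs \<equiv> rev (sorted_list_of_multiset M)"
  shows "xs ! 0 = Max_mset M" and "xs ! (size M - 1) = Min_mset M"
proof -
  have set: "set xs = set_mset M" and len: "length xs = size M"
    unfolding xs_def by (auto simp: size_mset[symmetric] simp del: size_mset)
  have "sorted_wrt (\<ge>) xs"
    by (simp add: xs_def sorted_wrt_rev)
  then have anti: "xs ! j \<le> xs ! i" if "i \<le> j" "j < size M" for i j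
    using that len by (cases "i = j") (auto simp: sorted_wrt_iff_nth_less)
  have pos: "0 < size M" using assms(1) by (simp add: nonempty_has_size)
  have mem: "xs ! i \<in># M" if "i < size M" for i
    using nth_mem[of i xs] that by (simp add: set len)
  have ex: "\<exists>i<size M. x = xs ! i" if "x \<in># M" for x
    using that by (metis set len in_set_conv_nth)
  show "xs ! 0 = Max_mset M"
    using pos by (intro Max_eqI[symmetric]) (auto dest!: ex intro: anti mem)
  show "xs ! (size M - 1) = Min_mset M"
    using pos by (intro Min_eqI[symmetric]) (auto dest!: ex intro: anti mem)
qed

lemma eigval_diagonalization:
  fixes A :: "real^'n^'n"
  assumes "orthogonal_matrix Q" "A = Q ** diag d ** transpose Q"
  shows "eigval 1 A = Max (range d)" and "eigval CARD('n) A = Min (range d)"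
proof -
  let ?M = "image_mset d (mset_set UNIV)"
  have "?M \<noteq> {#}" by (simp add: mset_set_empty_iff)
  note * = rev_sorted_list_of_multiset_extremes[OF this]
  show "eigval 1 A = Max (range d)" "eigval CARD('n) A = Min (range d)"
    using * by (simp_all add: eigval_def proots_charpoly_diagonalization[OF assms])
qed

section \<open>Rayleigh quotients and the operator norm\<close>

text \<open>In eigenbasis coordinates \<open>y\<close> the form is the sum of
  \<open>d i * (y $ i)\<^sup>2\<close> and \<open>x \<bullet> x\<close> is the sum of
  \<open>(y $ i)\<^sup>2\<close>; each \<open>d i\<close> is at most the maximum.\<close>

lemma rayleigh_le_eigval_1:
  assumes "symmetric_matrix A"
  shows "x \<bullet> (A *v x) \<le> eigval 1 A * (x \<bullet> x)"
proof -
  obtain Q d where Qd: "orthogonal_matrix Q" "A = Q ** diag d ** transpose Q"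
    using symmetric_matrix_diagonalization[OF assms] .
  show ?thesis
    unfolding diagonalization_quadratic_form[OF Qd(2)] orthogonal_matrix_inner[OF Qd(1), of x]
      eigval_diagonalization[OF Qd] sum_distrib_left
    by (intro sum_mono mult_right_mono) auto
qed

lemma rayleigh_ge_eigval_CARD:
  fixes A :: "real^'n^'n"
  assumes "symmetric_matrix A"
  shows "eigval CARD('n) A * (x \<bullet> x) \<le> x \<bullet> (A *v x)"
proof -
  obtain Q d where Qd: "orthogonal_matrix Q" "A = Q ** diag d ** transpose Q"
    using symmetric_matrix_diagonalization[OF assms] .
  show ?thesis
    unfolding diagonalization_quadratic_form[OF Qd(2)] orthogonal_matrix_inner[OF Qd(1), of x]
      eigval_diagonalization[OF Qd] sum_distrib_left
    by (intro sum_mono mult_right_mono) auto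
qed

text \<open>The extreme eigenvalues are attained among the \<open>d i\<close>, with the columns of
  \<open>Q\<close> as eigenvectors. Testing a form inequality on such a vector turns it into a bound
  on the eigenvalue.\<close>

lemma eigval_eigenvector:
  fixes A :: "real^'n^'n"
  assumes "symmetric_matrix A" "k = 1 \<or> k = CARD('n)"
  obtains v where "norm v = 1" "A *v v = eigval k A *\<^sub>R v"
proof -
  obtain Q d where Qd: "orthogonal_matrix Q" "A = Q ** diag d ** transpose Q"
    using symmetric_matrix_diagonalization[OF assms(1)] .
  have "eigval k A \<in> range d"
    using assms(2) Max_in[of "range d"] Min_in[of "range d"] eigval_diagonalization[OF Qd]
    by auto
  then obtain i where "eigval k A = d i" by blast
  with that[of "column i Q"] diagonalization_eigenvector[OF Qd, of i] show thesis by simp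
qed

lemma eigval_1_le:
  assumes "symmetric_matrix A" "\<And>x. x \<bullet> (A *v x) \<le> c * (x \<bullet> x)"
  shows "eigval 1 A \<le> c"
proof -
  obtain v where "norm v = 1" "A *v v = eigval 1 A *\<^sub>R v"
    using eigval_eigenvector[OF assms(1)] by blast
  with assms(2)[of v] show ?thesis by (simp add: dot_square_norm)
qed

lemma eigval_CARD_ge:
  fixes A :: "real^'n^'n"
  assumes "symmetric_matrix A" "\<And>x. c * (x \<bullet> x) \<le> x \<bullet> (A *v x)"
  shows "c \<le> eigval CARD('n) A"
proof -
  obtain v where "norm v = 1" "A *v v = eigval CARD('n) A *\<^sub>R v"
    using eigval_eigenvector[OF assms(1)] by blast
  with assms(2)[of v] show ?thesis by (simp add: dot_square_norm)
qed

text \<open>Testing the form on the columns of \<open>Q\<close> places every \<open>d i\<close>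
  between \<open>0\<close> and \<open>c\<close>. Semidefiniteness is what turns the one-sided bound
  into a bound on the absolute value; the orthogonal factors preserve norms.\<close>

lemma pos_semidef_op_norm_le:
  assumes A: "pos_semidef A" and le: "\<And>x. x \<bullet> (A *v x) \<le> c * (x \<bullet> x)"
  shows "op_norm A \<le> c"
proof -
  have sym: "symmetric_matrix A" using A by (simp add: pos_semidef_def)
  obtain Q d where Qd: "orthogonal_matrix Q" "A = Q ** diag d ** transpose Q"
    using symmetric_matrix_diagonalization[OF sym] .
  have d: "0 \<le> d i" "d i \<le> c" for i
  proof -
    have "column i Q \<bullet> (A *v column i Q) = d i" "column i Q \<bullet> column i Q = 1"
      using diagonalization_eigenvector[OF Qd, of i] by (simp_all add: dot_square_norm)
    then show "0 \<le> d i" "d i \<le> c"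
      using A le[of "column i Q"] unfolding pos_semidef_def by (metis, simp)
  qed
  show ?thesis
    unfolding op_norm_def
  proof (rule onorm_le)
    fix x
    let ?y = "transpose Q *v x"
    have "norm (A *v x) = norm (diag d *v ?y)"
      using orthogonal_matrix_norm[OF Qd(1)]
      by (simp only: Qd(2) flip: matrix_vector_mul_assoc)
    also have "\<dots> \<le> norm (c *\<^sub>R ?y)"
    proof (rule norm_le_componentwise_cart)
      fix i
      have "\<bar>d i\<bar> \<le> \<bar>c\<bar>" using d[of i] by linarith
      then show "norm ((diag d *v ?y) $ i) \<le> norm ((c *\<^sub>R ?y) $ i)"
        unfolding diag_mult_vec_nth by (simp add: abs_mult mult_right_mono)
    qed
    \<comment> \<open>Here \<open>c\<close> is nonnegative, since \<open>0 \<le> d i \<le> c\<close>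
      for some index.\<close>
    also have "\<dots> = c * norm x"
      using Qd(1) d order_trans[OF d] orthogonal_matrix_norm[of "transpose Q" x]
      by simp
    finally show "norm (A *v x) \<le> c * norm x" .
  qed
qed

subsection \<open>The principal square root\<close>

lemma ex_pos_semidef_sqrt:
  assumes "pos_semidef A"
  shows "\<exists>S. pos_semidef S \<and> S ** S = A"
proof -
  have sym: "symmetric_matrix A" using assms by (simp add: pos_semidef_def)
  obtain Q d where Qd: "orthogonal_matrix Q" "A = Q ** diag d ** transpose Q"
    using symmetric_matrix_diagonalization[OF sym] .
  have d: "0 \<le> d i" for i
  proof -
    have "column i Q \<bullet> (A *v column i Q) = d i"
      using diagonalization_eigenvector[OF Qd, of i] by (simp add: dot_square_norm)
    then show ?thesis using assms by (metis pos_semidef_def)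
  qed
  define S where "S = Q ** diag (\<lambda>i. sqrt (d i)) ** transpose Q"
  have "S ** S =
      Q ** (diag (\<lambda>i. sqrt (d i)) ** (transpose Q ** Q) ** diag (\<lambda>i. sqrt (d i))) ** transpose Q"
    by (simp add: S_def matrix_mul_assoc)
  also have "\<dots> = A"
    using Qd d by (simp add: orthogonal_matrix_def diag_mult)
  finally have "S ** S = A" .
  moreover have "symmetric_matrix S"
    by (simp add: symmetric_matrix_def S_def matrix_transpose_mul matrix_mul_assoc)
  moreover have "0 \<le> x \<bullet> (S *v x)" for x
    unfolding diagonalization_quadratic_form[OF S_def] using d by (intro sum_nonneg) auto
  ultimately show ?thesis by (auto simp: pos_semidef_def)
qed

text \<open>It suffices to compare \<open>S\<close> and \<open>T\<close> on an orthonormal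
  eigenbasis of \<open>T\<close>. If \<open>T\<close> maps \<open>v\<close> to \<open>d v\<close>,
  then \<open>S\<close> applied twice gives \<open>d\<^sup>2 v\<close>, and semidefiniteness of
  \<open>S\<close> selects the root \<open>d\<close>.\<close>

lemma pos_semidef_sqrt_unique:
  fixes S T :: "real^'n^'n"
  assumes S: "pos_semidef S" and T: "pos_semidef T" and eq: "S ** S = T ** T"
  shows "S = T"
proof -
  have sym: "symmetric_matrix S" "symmetric_matrix T"
    using S T by (simp_all add: pos_semidef_def)
  obtain Q d where Qd: "orthogonal_matrix Q" "T = Q ** diag d ** transpose Q"
    using symmetric_matrix_diagonalization[OF sym(2)] .
  have col: "S *v column i Q = T *v column i Q" for i
  proof -
    let ?v = "column i Q"
    have v: "T *v ?v = d i *\<^sub>R ?v" "norm ?v = 1"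
      using diagonalization_eigenvector[OF Qd, of i] by simp_all
    have d: "0 \<le> d i"
      using T v by (metis pos_semidef_def inner_scaleR_right dot_square_norm mult.right_neutral
          one_power2)
    have SS: "S *v (S *v ?v) = (d i)\<^sup>2 *\<^sub>R ?v"
      by (metis eq v(1) matrix_vector_mul_assoc matrix_vector_mult_scaleR power2_eq_square
          scaleR_scaleR)
    txt \<open>\<open>(S + d I) w = 0\<close> for the vector \<open>w = (S - d I) v\<close>, so \<open>w = 0\<close> when \<open>d > 0\<close>.\<close>
    define w where "w = S *v ?v - d i *\<^sub>R ?v"
    have "S *v w = - d i *\<^sub>R w"
      by (simp add: w_def SS algebra_simps power2_eq_square matrix_vector_mult_diff_distrib
          matrix_vector_mult_scaleR)
    then have "0 \<le> - (d i * (w \<bullet> w))"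
      using S by (metis pos_semidef_def inner_scaleR_right mult_minus_left)
    then have "d i = 0 \<or> w = 0"
      using d by (metis inner_eq_zero_iff inner_ge_zero antisym mult_eq_0_iff mult_nonneg_nonneg
          neg_0_le_iff_le)
    \<comment> \<open>For the eigenvalue \<open>0\<close>, symmetry gives that the squared norm of
      \<open>S *v v\<close> is \<open>v \<bullet> (S *v (S *v v)) = 0\<close>.\<close>
    moreover have "w = 0" if "d i = 0"
    proof -
      have "(S *v ?v) \<bullet> (S *v ?v) = 0"
        using SS that symmetric_matrix_inner[OF sym(1), of ?v "S *v ?v"] by simp
      then show ?thesis using that by (simp add: w_def)
    qed
    ultimately show ?thesis using v(1) by (auto simp: w_def)
  qed
  have "S ** Q = T ** Q"
  proof -
    have *: "(M ** Q) $ a $ i = (M *v column i Q) $ a" for M :: "real^'n^'n" and a i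
      by (simp add: matrix_matrix_mult_def matrix_vector_mult_def column_def)
    show ?thesis by (simp add: vec_eq_iff * col)
  qed
  then show ?thesis
    using Qd(1) by (metis matrix_mul_assoc matrix_mul_rid orthogonal_matrix_def)
qed

text \<open>Existence and uniqueness justify the definite description in
  \<open>matrix_sqrt\<close>.\<close>

lemma
  assumes "pos_semidef A"
  shows pos_semidef_matrix_sqrt: "pos_semidef (matrix_sqrt A)"
    and matrix_sqrt_mult_self: "matrix_sqrt A ** matrix_sqrt A = A"
proof -
  have "\<exists>!S. pos_semidef S \<and> S ** S = A"
    using ex_pos_semidef_sqrt[OF assms] pos_semidef_sqrt_unique by metis
  from theI'[OF this] show "pos_semidef (matrix_sqrt A)" "matrix_sqrt A ** matrix_sqrt A = A"
    by (simp_all add: matrix_sqrt_def)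
qed

section \<open>Inverses and inverse square roots\<close>

lemma
  assumes "invertible (A :: 'a::semiring_1^'n^'m)"
  shows matrix_inv_right: "A ** matrix_inv A = mat 1"
    and matrix_inv_left: "matrix_inv A ** A = mat 1"
  using someI_ex[OF assms[unfolded invertible_def]] by (simp_all add: matrix_inv_def)

lemma pos_def_invertible:
  assumes "pos_def A"
  shows "invertible A"
proof -
  have "x = 0" if "A *v x = 0" for x
    using assms that by (force simp: pos_def_def)
  then show ?thesis
    by (metis invertible_left_inverse matrix_left_invertible_ker)
qed

lemma pos_def_imp_pos_semidef: "pos_def A \<Longrightarrow> pos_semidef A"
  by (metis pos_def_def pos_semidef_def inner_zero_left less_imp_le order_refl)

lemma invertible_matrix_sqrt:
  assumes "pos_def A"
  shows "invertible (matrix_sqrt A)"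
proof -
  have "matrix_sqrt A ** matrix_sqrt A = A"
    using assms by (intro matrix_sqrt_mult_self pos_def_imp_pos_semidef)
  then show ?thesis
    using pos_def_invertible[OF assms]
    by (metis invertible_def invertible_left_inverse matrix_mul_assoc)
qed

lemma symmetric_matrix_matrix_inv:
  fixes A :: "real^'n^'n"
  assumes "symmetric_matrix A" "invertible A"
  shows "symmetric_matrix (matrix_inv A)"
  unfolding symmetric_matrix_def
  using assms matrix_inv_left[OF assms(2)] matrix_inv_right[OF assms(2)]
  by (metis matrix_mul_assoc matrix_mul_lid matrix_mul_rid matrix_transpose_mul symmetric_matrix_def
      transpose_mat)

lemma matrix_sqrt_inv_congruence:
  assumes "pos_def A"
  defines "S \<equiv> matrix_sqrt A"
  shows "invertible S" "transpose S = S" "S ** S = A"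
    "transpose (matrix_inv S) = matrix_inv S" "matrix_inv S ** A ** matrix_inv S = mat 1"
proof -
  note psd = pos_def_imp_pos_semidef[OF assms(1)]
  show inv: "invertible S" and sym: "transpose S = S" and sq: "S ** S = A"
    using invertible_matrix_sqrt[OF assms(1)] pos_semidef_matrix_sqrt[OF psd]
      matrix_sqrt_mult_self[OF psd]
    by (simp_all add: S_def pos_semidef_def symmetric_matrix_def)
  show "transpose (matrix_inv S) = matrix_inv S"
    using symmetric_matrix_matrix_inv inv sym by (simp add: symmetric_matrix_def)
  show "matrix_inv S ** A ** matrix_inv S = mat 1"
    unfolding sq[symmetric]
    by (metis inv matrix_inv_left matrix_inv_right matrix_mul_assoc matrix_mul_lid)
qed

subsection \<open>Congruence and preconditioning\<close>

lemma congruence_quadratic_form: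
  "x \<bullet> ((transpose W ** A ** W) *v x) = (W *v x) \<bullet> (A *v (W *v (x :: real^'n)))"
  by (simp only: inner_matrix_vector[of x "transpose W"] transpose_transpose
      flip: matrix_vector_mul_assoc)

lemma symmetric_matrix_congruence:
  fixes A :: "real^'n^'n"
  shows "symmetric_matrix A \<Longrightarrow> symmetric_matrix (transpose W ** A ** W)"
  by (simp add: symmetric_matrix_def matrix_transpose_mul matrix_mul_assoc)

lemma norm_isometry:
  fixes W :: "real^'d^'n"
  assumes "transpose W ** W = mat 1"
  shows "(W *v x) \<bullet> (W *v x) = x \<bullet> x"
  using congruence_quadratic_form[of x W "mat 1"] assms by simp

text \<open>For \<open>x = B *v y\<close> one has \<open>A *v x = y\<close>, so coercivity and
  Cauchy-Schwarz give \<open>c * (norm x)\<^sup>2 \<le> x \<bullet> y \<le> norm x * norm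
  y\<close>.\<close>

lemma op_norm_le_inverse:
  fixes A B :: "real^'n^'n"
  assumes AB: "A ** B = mat 1" and c: "0 < c" and ge: "\<And>x. c * (x \<bullet> x) \<le> x \<bullet> (A *v x)"
  shows "op_norm B \<le> inverse c"
  unfolding op_norm_def
proof (rule onorm_le)
  fix y
  let ?x = "B *v y"
  have "c * (norm ?x)\<^sup>2 \<le> ?x \<bullet> y"
    using ge[of ?x] AB by (simp add: matrix_vector_mul_assoc dot_square_norm)
  also have "\<dots> \<le> norm ?x * norm y" by (rule norm_cauchy_schwarz)
  finally have "norm ?x * (c * norm ?x) \<le> norm ?x * norm y"
    by (simp add: power2_eq_square mult_ac)
  then have "c * norm ?x \<le> norm y"
    by (cases "norm ?x = 0") (auto simp: mult_le_cancel_left_pos)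
  then show "norm ?x \<le> inverse c * norm y"
    using c by (simp add: field_simps)
qed

text \<open>The Loewner lower bound by \<open>mat m\<close> with \<open>m > 0\<close> makes the form
  coercive. This provides the inverse Hessians and the invertible square root used as
  preconditioner.\<close>

lemma well_conditioned_pos_def_hessian:
  assumes "well_conditioned P U" "symmetric_matrix (hessian U x)"
  shows "pos_def (hessian U x)"
proof -
  obtain m where "0 < m" "mat m \<preceq> hessian U x"
    using assms(1) unfolding well_conditioned_def by blast
  then have le: "0 \<le> v \<bullet> ((hessian U x - mat m) *v v)" for v
    by (simp add: loewner_le_def pos_semidef_def)
  have "mat m *v v = m *\<^sub>R v" for v :: "real^'a"
    by (simp add: vec_eq_iff matrix_vector_mult_def mat_def mult_delta_left)
  then have "m * (v \<bullet> v) \<le> v \<bullet> (hessian U x *v v)" for v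
    using le[of v] by (simp add: matrix_vector_mult_diff_rdistrib inner_diff_right)
  moreover have "0 < m * (v \<bullet> v)" if "v \<noteq> 0" for v :: "real^'a"
    using that \<open>0 < m\<close> by simp
  ultimately show ?thesis
    using assms(2) unfolding pos_def_def by (metis less_le_trans)
qed

lemma pos_def_eigval_CARD_pos:
  fixes A :: "real^'n^'n"
  assumes "pos_def A"
  shows "0 < eigval CARD('n) A"
proof -
  have "symmetric_matrix A" using assms by (simp add: pos_def_def)
  then obtain v where "norm v = 1" "A *v v = eigval CARD('n) A *\<^sub>R v"
    using eigval_eigenvector by blast
  then show ?thesis
    using assms by (metis dot_square_norm inner_scaleR_right mult.right_neutral norm_zero
        one_power2 pos_def_def zero_neq_one)
qed

lemma eigval_CARD_le_eigval_1:
  fixes A :: "real^'n^'n"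
  assumes "symmetric_matrix A"
  shows "eigval CARD('n) A \<le> eigval 1 A"
  using rayleigh_ge_eigval_CARD[OF assms, of "axis undefined 1"]
    rayleigh_le_eigval_1[OF assms, of "axis undefined 1"]
  by (simp add: inner_axis_axis)

lemma ennreal_inverse_antimono: "a \<le> b \<Longrightarrow> inverse b \<le> inverse (a :: ennreal)"
  including ennreal.lifting by transfer (rule ereal_inverse_antimono)

text \<open>Inverting the lower bound on \<open>i\<close> yields a second factor
  \<open>a / b\<close>. The side conditions exclude \<open>a = b = 0\<close> and
  \<open>a = b = top\<close>, where \<open>inverse (b / a)\<close> is \<open>top\<close> but
  \<open>a / b\<close> is \<open>0\<close>.\<close>

lemma ennreal_quotient_bound:
  fixes a b s i :: ennreal
  assumes s: "s \<le> a / b" and i: "b / a \<le> i" and a: "0 < a" and b: "b \<noteq> top"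
  shows "s / i \<le> (a / b)\<^sup>2"
proof -
  have "inverse (b / a) = a / b"
  \<comment> \<open>In the first case \<open>b / a\<close> is \<open>0\<close> and
    \<open>a / b\<close> is \<open>top\<close>; otherwise \<open>a\<close> and \<open>b\<close> are
    positive reals.\<close>
  proof (cases "a = top \<or> b = 0")
    case True
    then show ?thesis using a b by (auto simp: ennreal_top_divide)
  next
    case False
    then obtain p q where "a = ennreal p" "b = ennreal q" "0 < p" "0 < q"
      using a b by (metis ennreal_cases ennreal_0 order_le_less less_irrefl)
    then show ?thesis by (simp add: divide_ennreal inverse_ennreal)
  qed
  moreover have "s / i \<le> (a / b) * inverse (b / a)"
    unfolding divide_ennreal_def[of s] using s i by (intro mult_mono ennreal_inverse_antimono) auto
  ultimately show ?thesis by (simp add: power2_eq_square)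
qed

section \<open>The first inequality\<close>

text \<open>The first supremum is controlled by the largest eigenvalues of \<open>A x\<close>. The
  second concerns the inverse of the preconditioned Hessian \<open>G x\<close>, so the lower
  Rayleigh bound enters through its reciprocal.\<close>

lemma precond_condition_number_le:
  fixes Z :: "real^'d^'n" and \<Lambda> :: "real^'d \<Rightarrow> real^'n^'n"
  assumes hess: "\<And>x. hessian U x = transpose Z ** \<Lambda> x ** Z"
    and pd: "\<And>x. pos_def (hessian U x)"
    and sym: "\<And>x. symmetric_matrix (\<Lambda> x)" and pdxs: "pos_def (\<Lambda> xs)"
  defines "L \<equiv> matrix_sqrt (hessian U xs)"
    and "R \<equiv> matrix_inv (matrix_sqrt (\<Lambda> xs))"
  shows "precond_condition_number U L
           \<le> (SUP x. ennreal (eigval 1 (R ** \<Lambda> x ** R))) /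
             (INF x. ennreal (eigval CARD('n) (R ** \<Lambda> x ** R)))"
proof -
  define S where "S = matrix_sqrt (\<Lambda> xs)"
  define K where "K = matrix_inv L"
  note S = matrix_sqrt_inv_congruence[OF pdxs, folded S_def R_def[folded S_def]]
  note L = matrix_sqrt_inv_congruence[OF pd[of xs], folded L_def K_def]
  have R: "R ** S = mat 1" "S ** R = mat 1"
    using S(1) by (simp_all add: R_def S_def matrix_inv_left matrix_inv_right)
  have K: "K ** L = mat 1" "L ** K = mat 1"
    using L(1) by (simp_all add: K_def matrix_inv_left matrix_inv_right)
  define W where "W = S ** Z ** K"
  have Wt: "transpose W = K ** transpose Z ** S"
    by (simp add: W_def matrix_transpose_mul S(2) L(4) matrix_mul_assoc)
  have "transpose W ** W = K ** (transpose Z ** (S ** S) ** Z) ** K"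
    unfolding Wt by (simp add: W_def matrix_mul_assoc)
  then have iso: "transpose W ** W = mat 1"
    using L(5) by (simp add: S(3) hess)
  define A where "A x = R ** \<Lambda> x ** R" for x
  define G where "G x = K ** hessian U x ** K" for x
  have symA: "symmetric_matrix (A x)" for x
    using symmetric_matrix_congruence[OF sym, of R x] S(4) by (simp add: A_def)
  have G: "G x = transpose W ** A x ** W" for x
  proof -
    have "transpose W ** A x ** W = K ** transpose Z ** (S ** R) ** \<Lambda> x ** (R ** S) ** Z ** K"
      unfolding Wt by (simp add: W_def A_def matrix_mul_assoc)
    then show ?thesis by (simp add: R G_def hess matrix_mul_assoc)
  qed
  have form: "x \<bullet> (G y *v x) = (W *v x) \<bullet> (A y *v (W *v x))" for x y
    unfolding G by (rule congruence_quadratic_form)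
  have upper: "ennreal (op_norm (matrix_inv (transpose L) ** hessian U x ** matrix_inv L))
      \<le> ennreal (eigval 1 (A x))" for x
  proof -
    have "pos_semidef (transpose K ** hessian U x ** K)"
      using pos_def_imp_pos_semidef[OF pd[of x]] symmetric_matrix_congruence[of "hessian U x" K]
      by (simp only: pos_semidef_def congruence_quadratic_form) simp
    then have "pos_semidef (G x)" by (simp add: G_def L(4))
    then have "op_norm (G x) \<le> eigval 1 (A x)"
      by (rule pos_semidef_op_norm_le)
        (metis form norm_isometry[OF iso] rayleigh_le_eigval_1[OF symA])
    then show ?thesis by (simp add: G_def L(2) K_def ennreal_leI)
  qed
  have lower: "ennreal (op_norm (L ** matrix_inv (hessian U x) ** transpose L))
      \<le> inverse (ennreal (eigval CARD('n) (A x)))" for x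
  proof (cases "0 < eigval CARD('n) (A x)")
    case True
    let ?H = "hessian U x"
    \<comment> \<open>As \<open>L\<close> is symmetric, the matrix in the second supremum is a right
      inverse of \<open>G x\<close>.\<close>
    have "G x ** (L ** matrix_inv ?H ** L) = K ** (?H ** (K ** L) ** matrix_inv ?H) ** L"
      by (simp add: G_def matrix_mul_assoc)
    also have "\<dots> = mat 1"
      using matrix_inv_right[OF pos_def_invertible[OF pd[of x]]] by (simp add: K)
    finally have "op_norm (L ** matrix_inv ?H ** L) \<le> inverse (eigval CARD('n) (A x))"
      using True
      by (rule op_norm_le_inverse) (metis form norm_isometry[OF iso] rayleigh_ge_eigval_CARD[OF symA])
    then show ?thesis using True by (simp add: inverse_ennreal L(2) ennreal_leI)
  next
    \<comment> \<open>A nonpositive eigenvalue becomes \<open>0\<close> in \<open>ennreal\<close>;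
      its inverse is \<open>top\<close> and the bound is trivial.\<close>
    case False
    then show ?thesis by (simp add: ennreal_neg)
  qed
  show ?thesis
    unfolding precond_condition_number_def divide_ennreal_def A_def[symmetric]
  proof (intro mult_mono SUP_mono' upper SUP_least order_trans[OF lower])
    show "inverse (ennreal (eigval CARD('n) (A x)))
        \<le> inverse (INF x. ennreal (eigval CARD('n) (A x)))" for x
      by (intro ennreal_inverse_antimono INF_lower) simp
  qed auto
qed

section \<open>The second inequality\<close>

text \<open>Substituting \<open>R *v x\<close> turns the form of \<open>R ** A ** R\<close> into
  that of \<open>A\<close>. For \<open>B\<close> in place of \<open>A\<close> the result is
  \<open>x \<bullet> x\<close>, so the squared norm of \<open>R *v x\<close> lies between
  \<open>x \<bullet> x\<close> divided by the largest and by the least eigenvalue of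
  \<open>B\<close>.\<close>

lemma
  fixes A B :: "real^'n^'n"
  assumes "symmetric_matrix A" and B: "pos_def B"
  defines "R \<equiv> matrix_inv (matrix_sqrt B)"
  shows eigval_1_normalized_le:
      "ennreal (eigval 1 (R ** A ** R)) \<le> ennreal (eigval 1 A) / ennreal (eigval CARD('n) B)"
    and eigval_CARD_normalized_ge:
      "ennreal (eigval CARD('n) A) / ennreal (eigval 1 B) \<le> ennreal (eigval CARD('n) (R ** A ** R))"
proof -
  have symB: "symmetric_matrix B" using B by (simp add: pos_def_def)
  note S = matrix_sqrt_inv_congruence[OF B, folded R_def]
  have sym: "symmetric_matrix (R ** A ** R)"
    using symmetric_matrix_congruence[OF assms(1), of R] S(4) by simp
  have form: "x \<bullet> ((R ** M ** R) *v x) = (R *v x) \<bullet> (M *v (R *v x))" for x M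
    using congruence_quadratic_form[of x R M] S(4) by simp
  let ?mB = "eigval CARD('n) B" and ?MB = "eigval 1 B"
  \<comment> \<open>The largest eigenvalue of \<open>A\<close> may be negative. Truncating it at
    \<open>0\<close> permits multiplying by the upper bound on the squared norm, and
    \<open>ennreal\<close> performs the same truncation.\<close>
  let ?mA = "eigval CARD('n) A" and ?MA = "max 0 (eigval 1 A)"
  have mB: "0 < ?mB" and MB: "0 < ?MB"
    using pos_def_eigval_CARD_pos[OF B] eigval_CARD_le_eigval_1[OF symB] by linarith+
  have norm_le: "(R *v x) \<bullet> (R *v x) \<le> (x \<bullet> x) / ?mB"
    and norm_ge: "(x \<bullet> x) / ?MB \<le> (R *v x) \<bullet> (R *v x)" for x
    using form[of x B] S(5) rayleigh_ge_eigval_CARD[OF symB, of "R *v x"]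
      rayleigh_le_eigval_1[OF symB, of "R *v x"] mB MB
    by (simp_all add: field_simps)
  have "eigval 1 (R ** A ** R) \<le> ?MA / ?mB"
  proof (rule eigval_1_le[OF sym])
    fix x
    have "x \<bullet> ((R ** A ** R) *v x) \<le> eigval 1 A * ((R *v x) \<bullet> (R *v x))"
      unfolding form by (rule rayleigh_le_eigval_1[OF assms(1)])
    also have "\<dots> \<le> ?MA * ((x \<bullet> x) / ?mB)"
      using norm_le[of x] by (intro mult_mono) auto
    finally show "x \<bullet> ((R ** A ** R) *v x) \<le> ?MA / ?mB * (x \<bullet> x)" by simp
  qed
  then have "ennreal (eigval 1 (R ** A ** R)) \<le> ennreal ?MA / ennreal ?mB"
    using mB by (subst divide_ennreal) (auto intro: ennreal_leI)
  also have "ennreal ?MA = ennreal (eigval 1 A)"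
    by (simp add: max_def ennreal_neg)
  finally show "ennreal (eigval 1 (R ** A ** R)) \<le> ennreal (eigval 1 A) / ennreal ?mB" .
  show "ennreal ?mA / ennreal ?MB \<le> ennreal (eigval CARD('n) (R ** A ** R))"
  \<comment> \<open>The norm estimate can be multiplied by \<open>?mA\<close> only if that is
    nonnegative; otherwise the left-hand side is \<open>0\<close> in \<open>ennreal\<close>.\<close>
  proof (cases "0 \<le> ?mA")
    case True
    have "?mA / ?MB \<le> eigval CARD('n) (R ** A ** R)"
    proof (rule eigval_CARD_ge[OF sym])
      fix x
      have "?mA * ((x \<bullet> x) / ?MB) \<le> ?mA * ((R *v x) \<bullet> (R *v x))"
        using True norm_ge by (rule mult_left_mono[rotated])
      also have "\<dots> \<le> x \<bullet> ((R ** A ** R) *v x)"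
        unfolding form by (rule rayleigh_ge_eigval_CARD[OF assms(1)])
      finally show "?mA / ?MB * (x \<bullet> x) \<le> x \<bullet> ((R ** A ** R) *v x)" by simp
    qed
    then show ?thesis using True MB by (simp add: divide_ennreal ennreal_leI)
  qed (simp add: ennreal_neg)
qed

text \<open>Symmetry of all \<Lambda>(x) gives the ordered eigenvalues their meaning, and positive
  definiteness at x* gives an invertible square root. The infimum uses the index
  \<open>CARD('n)\<close>: on the range of the isometry \<open>W\<close>, a subspace of dimension d
  in an n-dimensional space, the lower bound guaranteed for the Rayleigh quotient is the least of
  all n eigenvalues.\<close>

theorem proposition15:
  fixes P :: "(real^'d) measure"
    and U :: "real^'d \<Rightarrow> real"
    and Z :: "real^'d^'n"
    and \<Lambda> :: "real^'d \<Rightarrow> real^'n^'n"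
    and xs :: "real^'d"
    and L :: "real^'d^'d"
    and R :: "real^'n^'n"
  assumes "well_conditioned P U"
    and "multiplicative_hessian U Z \<Lambda>"
    and "\<And>x. symmetric_matrix (\<Lambda> x)"
    and "pos_def (\<Lambda> xs)"
  defines "L \<equiv> matrix_sqrt (transpose Z ** \<Lambda> xs ** Z)"
    and "R \<equiv> matrix_inv (matrix_sqrt (\<Lambda> xs))"
  shows "precond_condition_number U L
           \<le> (SUP x. ennreal (eigval 1 (R ** \<Lambda> x ** R))) /
             (INF x. ennreal (eigval CARD('n) (R ** \<Lambda> x ** R)))
       \<and> (SUP x. ennreal (eigval 1 (R ** \<Lambda> x ** R))) /
         (INF x. ennreal (eigval CARD('n) (R ** \<Lambda> x ** R)))
           \<le> ((SUP x. ennreal (eigval 1 (\<Lambda> x))) /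
              (INF x. ennreal (eigval CARD('n) (\<Lambda> x))))\<^sup>2"
proof
  have hess: "hessian U x = transpose Z ** \<Lambda> x ** Z" for x
    using assms(2) by (simp add: multiplicative_hessian_def)
  have pd: "pos_def (hessian U x)" for x
    using well_conditioned_pos_def_hessian[OF assms(1)]
      symmetric_matrix_congruence[OF assms(3), where W = Z and x1 = x]
    by (simp only: hess)
  show "precond_condition_number U L
           \<le> (SUP x. ennreal (eigval 1 (R ** \<Lambda> x ** R))) /
             (INF x. ennreal (eigval CARD('n) (R ** \<Lambda> x ** R)))"
    using precond_condition_number_le[OF hess pd assms(3,4)] by (simp add: L_def R_def hess)
  show "(SUP x. ennreal (eigval 1 (R ** \<Lambda> x ** R))) /
         (INF x. ennreal (eigval CARD('n) (R ** \<Lambda> x ** R)))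
           \<le> ((SUP x. ennreal (eigval 1 (\<Lambda> x))) /
              (INF x. ennreal (eigval CARD('n) (\<Lambda> x))))\<^sup>2"
    (is "?s / ?i \<le> (?a / ?b)\<^sup>2")
  \<comment> \<open>The square arises because passing to the normalized matrices costs a factor once
    in the numerator and once in the denominator.\<close>
  proof (rule ennreal_quotient_bound)
    have b_le: "?b \<le> ennreal (eigval CARD('n) (\<Lambda> x))" for x by (rule INF_lower) simp
    have a_ge: "ennreal (eigval 1 (\<Lambda> x)) \<le> ?a" for x by (rule SUP_upper) simp
    show "?s \<le> ?a / ?b"
    proof (rule SUP_least)
      fix x
      \<comment> \<open>The numerator is taken at \<open>x\<close> and the denominator at
        \<open>xs\<close>; the supremum and the infimum bound them separately.\<close>
      have "ennreal (eigval 1 (\<Lambda> x)) / ennreal (eigval CARD('n) (\<Lambda> xs)) \<le> ?a / ?b"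
        unfolding divide_ennreal_def
        by (intro mult_mono ennreal_inverse_antimono a_ge b_le) auto
      with eigval_1_normalized_le[OF assms(3,4), folded R_def]
      show "ennreal (eigval 1 (R ** \<Lambda> x ** R)) \<le> ?a / ?b"
        by (rule order_trans)
    qed
    show "?b / ?a \<le> ?i"
    proof (rule INF_greatest)
      fix x
      have "?b / ?a \<le> ennreal (eigval CARD('n) (\<Lambda> x)) / ennreal (eigval 1 (\<Lambda> xs))"
        unfolding divide_ennreal_def
        by (intro mult_mono ennreal_inverse_antimono a_ge b_le) auto
      then show "?b / ?a \<le> ennreal (eigval CARD('n) (R ** \<Lambda> x ** R))"
        using eigval_CARD_normalized_ge[OF assms(3,4), folded R_def] by (rule order_trans)
    qed
    have "0 < eigval 1 (\<Lambda> xs)"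
      using pos_def_eigval_CARD_pos[OF assms(4)] eigval_CARD_le_eigval_1[OF assms(3), of xs]
      by linarith
    then show "0 < ?a"
      using a_ge[of xs] by (metis ennreal_less_zero_iff less_le_trans)
    show "?b \<noteq> top"
      using b_le[of xs] by (metis ennreal_neq_top top.extremum_uniqueI)
  qed
qed

end
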